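(* Suppose the natural variables satisfy the structural model $W=f_W(U_W)$, $Z=f_Z(W,U_Z)$, $A=f_A(Z,W,U_A)$, $Y=f_Y(A,W,U_Y)$ with $Z\perp (U_A,U_Y)\mid W$. Let $h^*(\cdot\mid W)$ be a stochastic intervention on the instrument, and suppose the intervened variables satisfy $W=f_W(U_W)$, $Z^{h^*}=f_Z^*(W,U_Z)$, $A^{h^*}=f_A(Z^{h^*},W,U_A)$, $Y^{h^*}=f_Y(A^{h^*},W,U_Y)$, where $Z^{h^*}\mid W$ has conditional density $h^*(\cdot\mid W)$ and $Z^{h^*}\perp (U_A,U_Y)\mid W$. Let $g(h^* )(A\mid W):=p(A^{h^*}\mid W)$ be the induced (implied) conditional marginal of the treatment. Then $$g(h^* )(A\mid W)=E_{Z\mid W\sim h^*}\,p(A\mid Z,W),$$ or equivalently $$g(h^* )(A\mid W)=\int p(A\mid Z,W)\,dH^*(Z\mid W).$$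
   Context: $W$ are baseline covariates, $Z$ an instrument, $A$ a treatment, $Y$ a response; $f_W,f_Z,f_A,f_Y,f_Z^*$ are arbitrary (measurable) functions and $U_W,U_Z,U_A,U_Y$ are error terms with an arbitrary joint distribution, with no conditional independence restrictions except those stated. The variable $Z$ does not enter $f_Y$. $P$ denotes the joint law of the natural variables $(W,Z,A,Y)$, and $p(A\mid Z,W)$ is the conditional density of $A$ given $(Z,W)$ under $P$. $H^*(\cdot\mid W)$ is the conditional probability measure with density $h^*(\cdot\mid W)$ with respect to a dominating measure $\mu(\cdot\mid W)$. The intervened model uses the same functions $f_W,f_A,f_Y$ and the same error terms as the natural model; only the equation for $Z$ is replaced. $p(A^{h^*}\mid W)$ is the conditional density of $A^{h^*}$ given $W$.
   Formalization: Adds that p(A|Z,W) is determined where h* puts mass: either the law of (Z^{h*},W) is absolutely continuous w.r.t. that of (Z,W), or p(.|z,w) is the density of f_A(z,w,U_A) under the law of U_A given W=w; otherwise p is arbitrary there and the formula can fail. *)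

theory Defs
  imports "HOL-Probability.Probability"
begin

text \<open>The conditional probability $P(E \mid V)$ of an event \<open>E\<close> given the random element \<open>V\<close>,
  as a function on the sample space; it is determined up to null sets.\<close>

definition prob_given ::
    "'s measure \<Rightarrow> 'v measure \<Rightarrow> ('s \<Rightarrow> 'v) \<Rightarrow> 's set \<Rightarrow> 's \<Rightarrow> ennreal" where
  "prob_given M MV V E = nn_cond_exp M (vimage_algebra (space M) V MV) (indicator E)"

definition cond_indep ::
    "'s measure \<Rightarrow> 'x measure \<Rightarrow> ('s \<Rightarrow> 'x) \<Rightarrow> 'y measure \<Rightarrow> ('s \<Rightarrow> 'y)
      \<Rightarrow> 'v measure \<Rightarrow> ('s \<Rightarrow> 'v) \<Rightarrow> bool" where
  "cond_indep M MX X MY Y MV V \<longleftrightarrow>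
    (\<forall>B\<in>sets MX. \<forall>C\<in>sets MY. AE \<omega> in M.
      prob_given M MV V {\<xi>\<in>space M. X \<xi> \<in> B \<and> Y \<xi> \<in> C} \<omega>
        = prob_given M MV V {\<xi>\<in>space M. X \<xi> \<in> B} \<omega>
          * prob_given M MV V {\<xi>\<in>space M. Y \<xi> \<in> C} \<omega>)"

definition cond_distribution ::
    "'s measure \<Rightarrow> 'x measure \<Rightarrow> ('s \<Rightarrow> 'x) \<Rightarrow> 'v measure \<Rightarrow> ('s \<Rightarrow> 'v)
      \<Rightarrow> ('v \<Rightarrow> 'x measure) \<Rightarrow> bool" where
  "cond_distribution M MX X MV V K \<longleftrightarrow>
    K \<in> MV \<rightarrow>\<^sub>M prob_algebra MX \<and>
    (\<forall>B\<in>sets MX. AE \<omega> in M.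
      prob_given M MV V {\<xi>\<in>space M. X \<xi> \<in> B} \<omega> = emeasure (K (V \<omega>)) B)"

text \<open>\<open>p v x\<close> is a version of the conditional density of \<open>X\<close> at \<open>x\<close> given \<open>V = v\<close>; the
  dominating measure \<open>\<nu>\<close> also carries the sigma-algebra of the space in which \<open>X\<close> takes values.\<close>

definition cond_density ::
    "'s measure \<Rightarrow> 'x measure \<Rightarrow> ('s \<Rightarrow> 'x) \<Rightarrow> 'v measure \<Rightarrow> ('s \<Rightarrow> 'v)
      \<Rightarrow> ('v \<Rightarrow> 'x \<Rightarrow> ennreal) \<Rightarrow> bool" where
  "cond_density M \<nu> X MV V p \<longleftrightarrow>
    (\<lambda>(v, x). p v x) \<in> borel_measurable (MV \<Otimes>\<^sub>M \<nu>) \<and>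
    (\<forall>B\<in>sets \<nu>. AE \<omega> in M.
      prob_given M MV V {\<xi>\<in>space M. X \<xi> \<in> B} \<omega> = (\<integral>\<^sup>+x\<in>B. p (V \<omega>) x \<partial>\<nu>))"

text \<open>A version of $p(A \mid Z, W)$ in the model $A = f_A(Z, W, U_A)$ with $Z \perp U_A \mid W$ is
  obtained by taking \<open>p (z, w)\<close> to be the density of $f_A(z, w, U_A)$ under the conditional law of
  $U_A$ given $W = w$. It is meaningful for every \<open>z\<close>, including values outside the
  support of the law of $Z$ given $W = w$.\<close>

definition structural_version ::
    "'s measure \<Rightarrow> 'u measure \<Rightarrow> ('s \<Rightarrow> 'u) \<Rightarrow> 'w measure \<Rightarrow> ('s \<Rightarrow> 'w) \<Rightarrow> 'z measure
      \<Rightarrow> ('z \<times> 'w \<times> 'u \<Rightarrow> 'a) \<Rightarrow> 'a measure \<Rightarrow> ('z \<times> 'w \<Rightarrow> 'a \<Rightarrow> ennreal) \<Rightarrow> bool" where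
  "structural_version M MUA UA MW W MZ fA \<nu> p \<longleftrightarrow>
    (\<exists>K. cond_distribution M MUA UA MW W K \<and>
      (AE w in distr M MW W. \<forall>z\<in>space MZ.
        distr (K w) \<nu> (\<lambda>u. fA (z, w, u)) = density \<nu> (p (z, w))))"

end

theory Submission
  imports Defs
begin

text \<open>
  The density \<open>p\<close> of \<open>A\<close> given \<open>(Z, W)\<close> is also a density of \<open>As\<close> given \<open>(Zs, W)\<close>, and integrating out \<open>Zs\<close>
  by its kernel \<open>Hs\<close> gives the density of \<open>As\<close> given \<open>W\<close>. The transfer from \<open>A\<close> to \<open>As\<close> rests on
  conditional independence: given \<open>(Z, W)\<close>, and likewise given \<open>(Zs, W)\<close>, an event \<open>UA \<in> C\<close> has the
  same conditional probability \<open>k W\<close>. If the law of \<open>(Zs, W)\<close> has a density \<open>r\<close> with respect to that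
  of \<open>(Z, W)\<close>, then the law of \<open>(Zs, W, UA)\<close> has density \<open>r (z, w)\<close> with respect to that of \<open>(Z, W, UA)\<close>,
  which is checked on rectangles and so needs no regular conditional distribution of \<open>UA\<close>. In the
  structural case the kernel of \<open>UA\<close> given \<open>W\<close> is available and its image under \<open>fA\<close> is the
  conditional law of \<open>As\<close> given \<open>(Zs, W)\<close>.
\<close>

text \<open>Rectangles form an intersection-stable generator containing the whole space, so
  finiteness of \<open>P\<close> on that one set suffices. Conditional statements that hold set by
  set, each with its own null set, become equalities of joint laws in this way.\<close>

lemma measure_eqI_rectangles:
  assumes sets: "sets P = sets (A \<Otimes>\<^sub>M B)" "sets Q = sets (A \<Otimes>\<^sub>M B)"
    and fin: "emeasure P (space (A \<Otimes>\<^sub>M B)) \<noteq> \<infinity>"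
    and eq: "\<And>a b. a \<in> sets A \<Longrightarrow> b \<in> sets B \<Longrightarrow> emeasure P (a \<times> b) = emeasure Q (a \<times> b)"
  shows "P = Q"
proof (rule measure_eqI_generator_eq[OF Int_stable_pair_measure_generator[of A B]])
  show "{a \<times> b |a b. a \<in> sets A \<and> b \<in> sets B} \<subseteq> Pow (space (A \<Otimes>\<^sub>M B))"
    using pair_measure_closed by (simp add: space_pair_measure)
  show "range (\<lambda>i::nat. space A \<times> space B) \<subseteq> {a \<times> b |a b. a \<in> sets A \<and> b \<in> sets B}"
    by auto
qed (use sets fin eq in \<open>auto simp: sets_pair_measure space_pair_measure\<close>)

context prob_space
begin

section \<open>Conditional probability given a random element\<close>

lemma sigma_finite_subalgebra_vimage_algebra:
  assumes "V \<in> M \<rightarrow>\<^sub>M MV"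
  shows "sigma_finite_subalgebra M (vimage_algebra (space M) V MV)"
proof -
  have "subalgebra M (vimage_algebra (space M) V MV)"
    unfolding subalgebra_def using sets_image_in_sets[OF refl assms] by simp
  then have "finite_measure_subalgebra M (vimage_algebra (space M) V MV)"
    by unfold_locales
  then show ?thesis
    by (rule finite_measure_subalgebra_is_sigma_finite)
qed

lemma nn_integral_prob_given:
  assumes V[measurable]: "V \<in> M \<rightarrow>\<^sub>M MV" and E[measurable]: "E \<in> sets M"
    and h[measurable]: "h \<in> borel_measurable MV"
  shows "(\<integral>\<^sup>+\<omega>. h (V \<omega>) * prob_given M MV V E \<omega> \<partial>M) = (\<integral>\<^sup>+\<omega>. h (V \<omega>) * indicator E \<omega> \<partial>M)"
proof -
  interpret V: sigma_finite_subalgebra M "vimage_algebra (space M) V MV"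
    by (rule sigma_finite_subalgebra_vimage_algebra[OF V])
  have "V \<in> vimage_algebra (space M) V MV \<rightarrow>\<^sub>M MV"
    using measurable_space[OF V] by (intro measurable_vimage_algebra1) auto
  then have "(\<lambda>\<omega>. h (V \<omega>)) \<in> borel_measurable (vimage_algebra (space M) V MV)"
    by measurable
  then show ?thesis
    unfolding prob_given_def by (rule V.nn_cond_exp_intg) measurable
qed

text \<open>Every set of the sigma-algebra generated by \<open>V\<close> is a preimage under
  \<open>V\<close>, so testing against indicators of \<open>V\<close> identifies the conditional
  expectation.\<close>

lemma prob_given_eqI:
  assumes V[measurable]: "V \<in> M \<rightarrow>\<^sub>M MV" and E[measurable]: "E \<in> sets M"
    and f[measurable]: "f \<in> borel_measurable MV"
    and eq: "\<And>G. G \<in> sets MV \<Longrightarrow>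
      (\<integral>\<^sup>+\<omega>. indicator G (V \<omega>) * indicator E \<omega> \<partial>M) = (\<integral>\<^sup>+\<omega>. indicator G (V \<omega>) * f (V \<omega>) \<partial>M)"
  shows "AE \<omega> in M. prob_given M MV V E \<omega> = f (V \<omega>)"
proof -
  interpret V: sigma_finite_subalgebra M "vimage_algebra (space M) V MV"
    by (rule sigma_finite_subalgebra_vimage_algebra[OF V])
  have sp: "V \<in> space M \<rightarrow> space MV"
    using measurable_space[OF V] by auto
  have "V \<in> vimage_algebra (space M) V MV \<rightarrow>\<^sub>M MV"
    by (intro measurable_vimage_algebra1 sp)
  then have fV: "(\<lambda>\<omega>. f (V \<omega>)) \<in> borel_measurable (vimage_algebra (space M) V MV)"
    by measurable
  have "AE \<omega> in M. f (V \<omega>) = nn_cond_exp M (vimage_algebra (space M) V MV) (indicator E) \<omega>"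
  proof (rule V.nn_cond_exp_charact[OF _ _ fV])
    fix S assume "S \<in> sets (vimage_algebra (space M) V MV)"
    then obtain G where G: "G \<in> sets MV" "S = V -` G \<inter> space M"
      by (auto simp: sets_vimage_algebra2[OF sp])
    have "(\<integral>\<^sup>+\<omega>\<in>S. indicator E \<omega> \<partial>M) = (\<integral>\<^sup>+\<omega>. indicator G (V \<omega>) * indicator E \<omega> \<partial>M)"
      using G by (intro nn_integral_cong) (auto split: split_indicator)
    also have "\<dots> = (\<integral>\<^sup>+\<omega>. indicator G (V \<omega>) * f (V \<omega>) \<partial>M)"
      by (rule eq[OF G(1)])
    also have "\<dots> = (\<integral>\<^sup>+\<omega>\<in>S. f (V \<omega>) \<partial>M)"
      using G by (intro nn_integral_cong) (auto split: split_indicator)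
    finally show "(\<integral>\<^sup>+\<omega>\<in>S. indicator E \<omega> \<partial>M) = (\<integral>\<^sup>+\<omega>\<in>S. f (V \<omega>) \<partial>M)" .
  qed measurable
  then show ?thesis
    unfolding prob_given_def by eventually_elim simp
qed

text \<open>Here \<open>f\<close> is a function on the sample space rather than on
  \<open>MV\<close>, so that a product of two conditional probabilities can be inserted
  directly.\<close>

lemma nn_integral_indicator_prob_given_eq:
  assumes V[measurable]: "V \<in> M \<rightarrow>\<^sub>M MV" and E[measurable]: "E \<in> sets M"
    and h[measurable]: "h \<in> borel_measurable MV"
    and f: "AE \<omega> in M. prob_given M MV V E \<omega> = f \<omega>"
  shows "(\<integral>\<^sup>+\<omega>. h (V \<omega>) * indicator E \<omega> \<partial>M) = (\<integral>\<^sup>+\<omega>. h (V \<omega>) * f \<omega> \<partial>M)"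
proof -
  have "(\<integral>\<^sup>+\<omega>. h (V \<omega>) * prob_given M MV V E \<omega> \<partial>M) = (\<integral>\<^sup>+\<omega>. h (V \<omega>) * f \<omega> \<partial>M)"
    using f by (intro nn_integral_cong_AE) auto
  then show ?thesis
    by (simp add: nn_integral_prob_given)
qed

text \<open>The factor \<open>k\<close> is a Radon-Nikodym derivative with respect to the law of
  \<open>V\<close>. It supplies one function on \<open>MV\<close> that can be evaluated along
  different conditioning variables.\<close>

lemma prob_given_factorization:
  assumes V[measurable]: "V \<in> M \<rightarrow>\<^sub>M MV" and E[measurable]: "E \<in> sets M"
  obtains k where "k \<in> borel_measurable MV" "AE \<omega> in M. prob_given M MV V E \<omega> = k (V \<omega>)"
proof -
  \<comment> \<open>\<open>?N\<close> gives \<open>G\<close> the probability that \<open>V\<close>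
    lies in \<open>G\<close> and \<open>E\<close> occurs; its density with respect to the law of
    \<open>V\<close> is the required \<open>k\<close>.\<close>
  let ?D = "distr M MV V" and ?N = "distr (density M (indicator E)) MV V"
  interpret D: prob_space ?D by (rule prob_space_distr) measurable
  have N: "emeasure ?N G = (\<integral>\<^sup>+\<omega>. indicator G (V \<omega>) * indicator E \<omega> \<partial>M)" if [measurable]: "G \<in> sets MV" for G
    by (subst emeasure_distr) (auto simp: emeasure_density intro!: nn_integral_cong split: split_indicator)
  have "absolutely_continuous ?D ?N"
    unfolding absolutely_continuous_def
  proof
    fix G assume G: "G \<in> null_sets ?D"
    then have [measurable]: "G \<in> sets MV" by auto
    have "AE \<omega> in M. V \<omega> \<notin> G"
      by (rule AE_distrD[OF V AE_not_in[OF G]])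
    then have "emeasure ?N G = (\<integral>\<^sup>+\<omega>. 0 \<partial>M)"
      unfolding N[OF \<open>G \<in> sets MV\<close>] by (intro nn_integral_cong_AE) (auto split: split_indicator)
    then show "G \<in> null_sets ?N" by auto
  qed
  then obtain k where k: "k \<in> borel_measurable ?D" "density ?D k = ?N"
    using D.Radon_Nikodym[of ?N] by auto
  have [measurable]: "k \<in> borel_measurable MV" using k(1) by simp
  have "AE \<omega> in M. prob_given M MV V E \<omega> = k (V \<omega>)"
  proof (rule prob_given_eqI)
    fix G assume [measurable]: "G \<in> sets MV"
    have "(\<integral>\<^sup>+\<omega>. indicator G (V \<omega>) * indicator E \<omega> \<partial>M) = emeasure (density ?D k) G"
      by (simp add: N k(2))
    also have "\<dots> = (\<integral>\<^sup>+\<omega>. indicator G (V \<omega>) * k (V \<omega>) \<partial>M)"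
      by (simp add: emeasure_density nn_integral_distr mult.commute)
    finally show "(\<integral>\<^sup>+\<omega>. indicator G (V \<omega>) * indicator E \<omega> \<partial>M) = (\<integral>\<^sup>+\<omega>. indicator G (V \<omega>) * k (V \<omega>) \<partial>M)" .
  qed measurable
  then show ?thesis
    by (rule that[rotated]) measurable
qed

section \<open>Conditional independence\<close>

text \<open>An event about \<open>U\<close> alone is the rectangle
  \<open>C \<times> space MU'\<close> for the pair. This passes from \<open>(UA, UY)\<close> to
  \<open>UA\<close>, the error in the treatment equation.\<close>

lemma cond_indep_Pair_fst:
  assumes U: "\<And>\<omega>. \<omega> \<in> space M \<Longrightarrow> U' \<omega> \<in> space MU'"
    and "cond_indep M MX X (MU \<Otimes>\<^sub>M MU') (\<lambda>\<omega>. (U \<omega>, U' \<omega>)) MV V"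
  shows "cond_indep M MX X MU U MV V"
  unfolding cond_indep_def
proof safe
  fix B C assume "B \<in> sets MX" "C \<in> sets MU"
  then have "C \<times> space MU' \<in> sets (MU \<Otimes>\<^sub>M MU')" by auto
  moreover have "{\<xi> \<in> space M. X \<xi> \<in> B \<and> (U \<xi>, U' \<xi>) \<in> C \<times> space MU'} = {\<xi> \<in> space M. X \<xi> \<in> B \<and> U \<xi> \<in> C}"
      "{\<xi> \<in> space M. (U \<xi>, U' \<xi>) \<in> C \<times> space MU'} = {\<xi> \<in> space M. U \<xi> \<in> C}"
    using U by auto
  moreover note assms(2)[unfolded cond_indep_def, rule_format, OF \<open>B \<in> sets MX\<close>]
  ultimately show "AE \<omega> in M. prob_given M MV V {\<xi> \<in> space M. X \<xi> \<in> B \<and> U \<xi> \<in> C} \<omega> =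
      prob_given M MV V {\<xi> \<in> space M. X \<xi> \<in> B} \<omega> * prob_given M MV V {\<xi> \<in> space M. U \<xi> \<in> C} \<omega>"
    by fastforce
qed

text \<open>Conditional independence means that \<open>X\<close> adds no information about
  \<open>Y\<close> once \<open>V\<close> is known. The version \<open>k\<close> is prescribed in
  advance so that the same \<open>k\<close> can serve for \<open>Z\<close> and for
  \<open>Zs\<close>.\<close>

lemma prob_given_cond_indep:
  assumes X[measurable]: "X \<in> M \<rightarrow>\<^sub>M MX" and Y[measurable]: "Y \<in> M \<rightarrow>\<^sub>M MY" and V[measurable]: "V \<in> M \<rightarrow>\<^sub>M MV"
    and indep: "cond_indep M MX X MY Y MV V" and C[measurable]: "C \<in> sets MY"
    and k[measurable]: "k \<in> borel_measurable MV"
    and kV: "AE \<omega> in M. prob_given M MV V {\<xi>\<in>space M. Y \<xi> \<in> C} \<omega> = k (V \<omega>)"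
  shows "AE \<omega> in M. prob_given M (MX \<Otimes>\<^sub>M MV) (\<lambda>\<omega>. (X \<omega>, V \<omega>)) {\<xi>\<in>space M. Y \<xi> \<in> C} \<omega> = k (V \<omega>)"
proof -
  let ?E = "{\<xi>\<in>space M. Y \<xi> \<in> C}" and ?T = "\<lambda>\<omega>. (X \<omega>, V \<omega>)" and ?N = "MX \<Otimes>\<^sub>M MV"
  let ?P = "distr (density M (indicator ?E)) ?N ?T" and ?Q = "distr (density M (\<lambda>\<omega>. k (V \<omega>))) ?N ?T"
  have P: "emeasure ?P F = (\<integral>\<^sup>+\<omega>. indicator F (?T \<omega>) * indicator ?E \<omega> \<partial>M)" if [measurable]: "F \<in> sets ?N" for F
    by (subst emeasure_distr) (auto simp: emeasure_density intro!: nn_integral_cong split: split_indicator)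
  have Q: "emeasure ?Q F = (\<integral>\<^sup>+\<omega>. indicator F (?T \<omega>) * k (V \<omega>) \<partial>M)" if [measurable]: "F \<in> sets ?N" for F
    by (subst emeasure_distr) (auto simp: emeasure_density intro!: nn_integral_cong split: split_indicator)
  have "?P = ?Q"
  proof (rule measure_eqI_rectangles)
    have "emeasure ?P (space ?N) \<le> (\<integral>\<^sup>+\<omega>. 1 \<partial>M)"
      unfolding P[OF sets.top] by (intro nn_integral_mono) (auto split: split_indicator)
    then show "emeasure ?P (space ?N) \<noteq> \<infinity>"
      by (auto simp: emeasure_space_1 top_unique)
  next
    fix B G assume [measurable]: "B \<in> sets MX" and [measurable]: "G \<in> sets MV"
    let ?X = "{\<xi>\<in>space M. X \<xi> \<in> B}"
    have "emeasure ?P (B \<times> G) = (\<integral>\<^sup>+\<omega>. indicator G (V \<omega>) * indicator {\<xi>\<in>space M. X \<xi> \<in> B \<and> Y \<xi> \<in> C} \<omega> \<partial>M)"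
      by (subst P) (auto intro!: nn_integral_cong split: split_indicator)
    also have "\<dots> = (\<integral>\<^sup>+\<omega>. indicator G (V \<omega>) * (prob_given M MV V ?X \<omega> * prob_given M MV V ?E \<omega>) \<partial>M)"
      using indep by (intro nn_integral_indicator_prob_given_eq[OF V]) (simp_all add: cond_indep_def)
    \<comment> \<open>With \<open>k (V \<omega>)\<close> absorbed into the weight, the weight is a
      function of \<open>V\<close>, so the remaining conditional probability of \<open>?X\<close>
      can be turned back into an indicator.\<close>
    also have "\<dots> = (\<integral>\<^sup>+\<omega>. (indicator G (V \<omega>) * k (V \<omega>)) * prob_given M MV V ?X \<omega> \<partial>M)"
      using kV by (intro nn_integral_cong_AE) (auto simp: mult.assoc mult.commute mult.left_commute)
    also have "\<dots> = (\<integral>\<^sup>+\<omega>. (indicator G (V \<omega>) * k (V \<omega>)) * indicator ?X \<omega> \<partial>M)"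
      by (rule nn_integral_prob_given[where h="\<lambda>v. indicator G v * k v"]) measurable
    also have "\<dots> = emeasure ?Q (B \<times> G)"
      by (subst Q) (auto intro!: nn_integral_cong split: split_indicator)
    finally show "emeasure ?P (B \<times> G) = emeasure ?Q (B \<times> G)" .
  qed auto
  then have "(\<integral>\<^sup>+\<omega>. indicator F (?T \<omega>) * indicator ?E \<omega> \<partial>M) = (\<integral>\<^sup>+\<omega>. indicator F (?T \<omega>) * k (V \<omega>) \<partial>M)"
    if "F \<in> sets ?N" for F
    using P[OF that] Q[OF that] by simp
  then have "AE \<omega> in M. prob_given M ?N ?T ?E \<omega> = (\<lambda>(x, v). k v) (?T \<omega>)"
    by (intro prob_given_eqI) simp_all
  then show ?thesis by simp
qed

text \<open>The same fact for kernels: for each \<open>C\<close>, the version \<open>k\<close> is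
  the mass that \<open>K v\<close> gives to \<open>C\<close>.\<close>

lemma cond_distribution_cond_indep:
  assumes X[measurable]: "X \<in> M \<rightarrow>\<^sub>M MX" and Y[measurable]: "Y \<in> M \<rightarrow>\<^sub>M MY" and V[measurable]: "V \<in> M \<rightarrow>\<^sub>M MV"
    and indep: "cond_indep M MX X MY Y MV V" and K: "cond_distribution M MY Y MV V K"
  shows "cond_distribution M MY Y (MX \<Otimes>\<^sub>M MV) (\<lambda>\<omega>. (X \<omega>, V \<omega>)) (\<lambda>(x, v). K v)"
proof -
  have [measurable]: "K \<in> MV \<rightarrow>\<^sub>M prob_algebra MY"
    using K by (simp add: cond_distribution_def)
  then have [measurable]: "K \<in> MV \<rightarrow>\<^sub>M subprob_algebra MY"
    by (rule measurable_prob_algebraD)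
  show ?thesis
    unfolding cond_distribution_def
  proof (intro conjI ballI)
    fix C assume [measurable]: "C \<in> sets MY"
    have "AE \<omega> in M. prob_given M (MX \<Otimes>\<^sub>M MV) (\<lambda>\<omega>. (X \<omega>, V \<omega>)) {\<xi>\<in>space M. Y \<xi> \<in> C} \<omega>
        = emeasure (K (V \<omega>)) C"
      using K by (intro prob_given_cond_indep[OF X Y V indep, where k="\<lambda>v. emeasure (K v) C"])
        (auto simp: cond_distribution_def)
    then show "AE \<omega> in M. prob_given M (MX \<Otimes>\<^sub>M MV) (\<lambda>\<omega>. (X \<omega>, V \<omega>)) {\<xi>\<in>space M. Y \<xi> \<in> C} \<omega>
        = emeasure (case (X \<omega>, V \<omega>) of (x, v) \<Rightarrow> K v) C" by simp
  qed measurable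
qed

section \<open>Disintegration along a kernel\<close>

text \<open>The kernel property determines the joint law of \<open>(V, X)\<close> on rectangles,
  hence everywhere, so integrands depending jointly on both coordinates can be integrated in two
  stages.\<close>

lemma nn_integral_cond_distribution:
  assumes X[measurable]: "X \<in> M \<rightarrow>\<^sub>M MX" and V[measurable]: "V \<in> M \<rightarrow>\<^sub>M MV"
    and K: "cond_distribution M MX X MV V K"
    and f[measurable]: "f \<in> borel_measurable (MV \<Otimes>\<^sub>M MX)"
  shows "(\<integral>\<^sup>+\<omega>. f (V \<omega>, X \<omega>) \<partial>M) = (\<integral>\<^sup>+\<omega>. \<integral>\<^sup>+x. f (V \<omega>, x) \<partial>K (V \<omega>) \<partial>M)"
proof -
  have "K \<in> MV \<rightarrow>\<^sub>M prob_algebra MX"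
    using K by (simp add: cond_distribution_def)
  then have KS[measurable]: "K \<in> MV \<rightarrow>\<^sub>M subprob_algebra MX"
    by (rule measurable_prob_algebraD)
  have setsK[measurable_cong]: "sets (K v) = sets MX" if "v \<in> space MV" for v
    using subprob_measurableD(2)[OF KS that] .
  \<comment> \<open>\<open>?L v\<close> places \<open>K v\<close> on the slice over
    \<open>v\<close>; mixing these slices over the law of \<open>V\<close> should give the joint
    law.\<close>
  let ?L = "\<lambda>v. distr (K v) (MV \<Otimes>\<^sub>M MX) (Pair v)"
  let ?P = "distr M (MV \<Otimes>\<^sub>M MX) (\<lambda>\<omega>. (V \<omega>, X \<omega>))" and ?Q = "distr M MV V \<bind> ?L"
  have L: "?L \<in> distr M MV V \<rightarrow>\<^sub>M subprob_algebra (MV \<Otimes>\<^sub>M MX)"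
    using measurable_distr2[of Pair MV MX "MV \<Otimes>\<^sub>M MX" K] by simp
  have PK: "(\<lambda>x. Pair v x) \<in> K v \<rightarrow>\<^sub>M MV \<Otimes>\<^sub>M MX" if "v \<in> space MV" for v
    using that by (simp add: measurable_cong_sets[OF setsK[OF that] refl])
  have ne: "space MV \<noteq> {}"
    using measurable_space[OF V] not_empty by auto
  have "?P = ?Q"
  proof (rule measure_eqI_rectangles)
    show "sets ?Q = sets (MV \<Otimes>\<^sub>M MX)"
      using ne by (subst sets_bind) auto
    interpret P: prob_space ?P by (rule prob_space_distr) measurable
    show "emeasure ?P (space (MV \<Otimes>\<^sub>M MX)) \<noteq> \<infinity>"
      using P.emeasure_finite by (simp add: top.not_eq_extremum)
  next
    fix G B assume [measurable]: "G \<in> sets MV" and [measurable]: "B \<in> sets MX"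
    let ?E = "{\<xi>\<in>space M. X \<xi> \<in> B}"
    have "emeasure ?P (G \<times> B) = (\<integral>\<^sup>+\<omega>. indicator (G \<times> B) (V \<omega>, X \<omega>) \<partial>M)"
      by (simp add: nn_integral_distr flip: nn_integral_indicator)
    also have "\<dots> = (\<integral>\<^sup>+\<omega>. indicator G (V \<omega>) * indicator ?E \<omega> \<partial>M)"
      by (auto intro!: nn_integral_cong split: split_indicator)
    also have "\<dots> = (\<integral>\<^sup>+\<omega>. indicator G (V \<omega>) * emeasure (K (V \<omega>)) B \<partial>M)"
      using K by (intro nn_integral_indicator_prob_given_eq[OF V]) (simp_all add: cond_distribution_def)
    also have "\<dots> = (\<integral>\<^sup>+v. indicator G v * emeasure (K v) B \<partial>distr M MV V)"
      by (subst nn_integral_distr) auto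
    also have "\<dots> = (\<integral>\<^sup>+v. emeasure (?L v) (G \<times> B) \<partial>distr M MV V)"
    proof (rule nn_integral_cong)
      fix v assume "v \<in> space (distr M MV V)"
      then have v: "v \<in> space MV" by simp
      have "Pair v -` (G \<times> B) \<inter> space (K v) = (if v \<in> G then B else {})"
        using sets.sets_into_space[OF \<open>B \<in> sets MX\<close>] sets_eq_imp_space_eq[OF setsK[OF v]] by auto
      then show "indicator G v * emeasure (K v) B = emeasure (?L v) (G \<times> B)"
        by (subst emeasure_distr[OF PK[OF v]]) (auto split: split_indicator)
    qed
    also have "\<dots> = emeasure ?Q (G \<times> B)"
      using ne by (subst emeasure_bind[OF _ L]) auto
    finally show "emeasure ?P (G \<times> B) = emeasure ?Q (G \<times> B)" .
  qed simp
  have "(\<integral>\<^sup>+\<omega>. f (V \<omega>, X \<omega>) \<partial>M) = integral\<^sup>N ?P f"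
    by (subst nn_integral_distr) auto
  also have "\<dots> = (\<integral>\<^sup>+v. \<integral>\<^sup>+y. f y \<partial>?L v \<partial>distr M MV V)"
    unfolding \<open>?P = ?Q\<close> by (rule nn_integral_bind[OF f L])
  also have "\<dots> = (\<integral>\<^sup>+v. \<integral>\<^sup>+x. f (v, x) \<partial>K v \<partial>distr M MV V)"
    by (intro nn_integral_cong nn_integral_distr PK) simp_all
  also have "\<dots> = (\<integral>\<^sup>+\<omega>. \<integral>\<^sup>+x. f (V \<omega>, x) \<partial>K (V \<omega>) \<partial>M)"
    by (subst nn_integral_distr) (auto intro!: nn_integral_measurable_subprob_algebra2[where N=MX])
  finally show ?thesis .
qed

section \<open>Transfer to the intervened conditioning variable\<close>

text \<open>A common conditional law of \<open>U\<close> makes the joint laws of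
  \<open>(T', U)\<close> and \<open>(T, U)\<close> differ only by the density \<open>r\<close> of
  the first coordinate. Since \<open>r\<close> depends on that coordinate alone, it does not alter
  conditional probabilities given it. The set \<open>D\<close> couples both coordinates, as the
  treatment equation requires.\<close>

lemma prob_given_absolutely_continuous:
  assumes T[measurable]: "T \<in> M \<rightarrow>\<^sub>M N" and T'[measurable]: "T' \<in> M \<rightarrow>\<^sub>M N" and U[measurable]: "U \<in> M \<rightarrow>\<^sub>M MU"
    and ac: "absolutely_continuous (distr M N T) (distr M N T')"
    and common: "\<And>C. C \<in> sets MU \<Longrightarrow> \<exists>k\<in>borel_measurable N.
      (AE \<omega> in M. prob_given M N T {\<xi>\<in>space M. U \<xi> \<in> C} \<omega> = k (T \<omega>)) \<and>
      (AE \<omega> in M. prob_given M N T' {\<xi>\<in>space M. U \<xi> \<in> C} \<omega> = k (T' \<omega>))"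
    and D[measurable]: "D \<in> sets (N \<Otimes>\<^sub>M MU)" and f[measurable]: "f \<in> borel_measurable N"
    and fT: "AE \<omega> in M. prob_given M N T {\<xi>\<in>space M. (T \<xi>, U \<xi>) \<in> D} \<omega> = f (T \<omega>)"
  shows "AE \<omega> in M. prob_given M N T' {\<xi>\<in>space M. (T' \<xi>, U \<xi>) \<in> D} \<omega> = f (T' \<omega>)"
proof -
  interpret T: prob_space "distr M N T" by (rule prob_space_distr) measurable
  obtain r where "r \<in> borel_measurable (distr M N T)" and r: "density (distr M N T) r = distr M N T'"
    using T.Radon_Nikodym[OF ac] by auto
  then have [measurable]: "r \<in> borel_measurable N" by simp
  have change: "(\<integral>\<^sup>+\<omega>. h (T' \<omega>) \<partial>M) = (\<integral>\<^sup>+\<omega>. r (T \<omega>) * h (T \<omega>) \<partial>M)"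
    if [measurable]: "h \<in> borel_measurable N" for h
  proof -
    have "(\<integral>\<^sup>+\<omega>. h (T' \<omega>) \<partial>M) = integral\<^sup>N (density (distr M N T) r) h"
      unfolding r by (simp add: nn_integral_distr)
    also have "\<dots> = (\<integral>\<^sup>+\<omega>. r (T \<omega>) * h (T \<omega>) \<partial>M)"
      by (simp add: nn_integral_density nn_integral_distr)
    finally show ?thesis .
  qed
  let ?N = "N \<Otimes>\<^sub>M MU"
  let ?P = "distr M ?N (\<lambda>\<omega>. (T' \<omega>, U \<omega>))"
  \<comment> \<open>Weighting \<open>M\<close> by \<open>r (T \<omega>)\<close> before pushing
    forward yields the law of \<open>(T, U)\<close> with density \<open>r\<close> in the first
    coordinate.\<close>
  let ?Q = "distr (density M (\<lambda>\<omega>. r (T \<omega>))) ?N (\<lambda>\<omega>. (T \<omega>, U \<omega>))"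
  have P: "(\<integral>\<^sup>+\<omega>. \<phi> (T' \<omega>, U \<omega>) \<partial>M) = integral\<^sup>N ?P \<phi>" if [measurable]: "\<phi> \<in> borel_measurable ?N" for \<phi>
    by (simp add: nn_integral_distr)
  have Q: "(\<integral>\<^sup>+\<omega>. r (T \<omega>) * \<phi> (T \<omega>, U \<omega>) \<partial>M) = integral\<^sup>N ?Q \<phi>" if [measurable]: "\<phi> \<in> borel_measurable ?N" for \<phi>
    by (subst nn_integral_distr) (simp_all add: nn_integral_density)
  have "?P = ?Q"
  proof (rule measure_eqI_rectangles)
    interpret P: prob_space ?P by (rule prob_space_distr) measurable
    show "emeasure ?P (space ?N) \<noteq> \<infinity>"
      using P.emeasure_finite by (simp add: top.not_eq_extremum)
  next
    fix F C assume [measurable]: "F \<in> sets N" and [measurable]: "C \<in> sets MU"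
    let ?C = "{\<xi>\<in>space M. U \<xi> \<in> C}"
    obtain k where [measurable]: "k \<in> borel_measurable N"
      and k: "AE \<omega> in M. prob_given M N T ?C \<omega> = k (T \<omega>)" "AE \<omega> in M. prob_given M N T' ?C \<omega> = k (T' \<omega>)"
      using common[OF \<open>C \<in> sets MU\<close>] by blast
    have "emeasure ?P (F \<times> C) = (\<integral>\<^sup>+\<omega>. indicator (F \<times> C) (T' \<omega>, U \<omega>) \<partial>M)"
      by (simp add: P)
    also have "\<dots> = (\<integral>\<^sup>+\<omega>. indicator F (T' \<omega>) * indicator ?C \<omega> \<partial>M)"
      by (auto intro!: nn_integral_cong split: split_indicator)
    also have "\<dots> = (\<integral>\<^sup>+\<omega>. indicator F (T' \<omega>) * k (T' \<omega>) \<partial>M)"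
      by (rule nn_integral_indicator_prob_given_eq[OF T' _ _ k(2)]) measurable
    \<comment> \<open>Once \<open>U\<close> is replaced by \<open>k\<close>, the integrand is a
      function of \<open>T'\<close> only and \<open>change\<close> applies; the shared
      \<open>k\<close> then restores the event about \<open>U\<close> on the side of
      \<open>T\<close>.\<close>
    also have "\<dots> = (\<integral>\<^sup>+\<omega>. (r (T \<omega>) * indicator F (T \<omega>)) * k (T \<omega>) \<partial>M)"
      using change[of "\<lambda>t. indicator F t * k t"] by (simp add: mult.assoc)
    also have "\<dots> = (\<integral>\<^sup>+\<omega>. (r (T \<omega>) * indicator F (T \<omega>)) * indicator ?C \<omega> \<partial>M)"
      by (rule nn_integral_indicator_prob_given_eq[where h="\<lambda>t. r t * indicator F t", OF T _ _ k(1), symmetric])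
        measurable
    also have "\<dots> = (\<integral>\<^sup>+\<omega>. r (T \<omega>) * indicator (F \<times> C) (T \<omega>, U \<omega>) \<partial>M)"
      by (auto intro!: nn_integral_cong split: split_indicator)
    also have "\<dots> = emeasure ?Q (F \<times> C)"
      by (subst Q) simp_all
    finally show "emeasure ?P (F \<times> C) = emeasure ?Q (F \<times> C)" .
  qed simp_all
  show ?thesis
  proof (rule prob_given_eqI)
    fix F assume [measurable]: "F \<in> sets N"
    let ?D = "{\<xi>\<in>space M. (T \<xi>, U \<xi>) \<in> D}" and ?D' = "{\<xi>\<in>space M. (T' \<xi>, U \<xi>) \<in> D}"
    let ?\<phi> = "\<lambda>x. indicator F (fst x) * indicator D x :: ennreal"
    have "(\<integral>\<^sup>+\<omega>. indicator F (T' \<omega>) * indicator ?D' \<omega> \<partial>M) = (\<integral>\<^sup>+\<omega>. ?\<phi> (T' \<omega>, U \<omega>) \<partial>M)"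
      by (auto intro!: nn_integral_cong split: split_indicator)
    also have "\<dots> = (\<integral>\<^sup>+\<omega>. r (T \<omega>) * ?\<phi> (T \<omega>, U \<omega>) \<partial>M)"
      using P[of ?\<phi>] Q[of ?\<phi>] \<open>?P = ?Q\<close> by simp
    also have "\<dots> = (\<integral>\<^sup>+\<omega>. (r (T \<omega>) * indicator F (T \<omega>)) * indicator ?D \<omega> \<partial>M)"
      by (auto intro!: nn_integral_cong split: split_indicator)
    also have "\<dots> = (\<integral>\<^sup>+\<omega>. (r (T \<omega>) * indicator F (T \<omega>)) * f (T \<omega>) \<partial>M)"
      by (rule nn_integral_indicator_prob_given_eq[where h="\<lambda>t. r t * indicator F t", OF T _ _ fT]) measurable
    also have "\<dots> = (\<integral>\<^sup>+\<omega>. indicator F (T' \<omega>) * f (T' \<omega>) \<partial>M)"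
      using change[of "\<lambda>t. indicator F t * f t"] by (simp add: mult.assoc)
    finally show "(\<integral>\<^sup>+\<omega>. indicator F (T' \<omega>) * indicator ?D' \<omega> \<partial>M) = (\<integral>\<^sup>+\<omega>. indicator F (T' \<omega>) * f (T' \<omega>) \<partial>M)" .
  qed measurable
qed

text \<open>Given \<open>T = t\<close>, the element \<open>U\<close> has law \<open>K t\<close>, so
  \<open>t\<close> can be substituted in the first argument of \<open>g\<close>. Disintegration
  justifies the substitution although \<open>g\<close> mixes both arguments.\<close>

lemma prob_given_image_cond_distribution:
  assumes U[measurable]: "U \<in> M \<rightarrow>\<^sub>M MU" and T[measurable]: "T \<in> M \<rightarrow>\<^sub>M N"
    and K: "cond_distribution M MU U N T K"
    and g[measurable]: "g \<in> N \<Otimes>\<^sub>M MU \<rightarrow>\<^sub>M L" and B[measurable]: "B \<in> sets L"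
  shows "AE \<omega> in M. prob_given M N T {\<xi>\<in>space M. g (T \<xi>, U \<xi>) \<in> B} \<omega>
    = emeasure (distr (K (T \<omega>)) L (\<lambda>u. g (T \<omega>, u))) B"
proof -
  have "K \<in> N \<rightarrow>\<^sub>M prob_algebra MU"
    using K by (simp add: cond_distribution_def)
  then have KS[measurable]: "K \<in> N \<rightarrow>\<^sub>M subprob_algebra MU"
    by (rule measurable_prob_algebraD)
  have meas: "(\<lambda>t. distr (K t) L (\<lambda>u. g (t, u))) \<in> N \<rightarrow>\<^sub>M subprob_algebra L"
    by (rule measurable_distr2[OF _ KS]) simp
  show ?thesis
  proof (rule prob_given_eqI)
    show "(\<lambda>t. emeasure (distr (K t) L (\<lambda>u. g (t, u))) B) \<in> borel_measurable N"
      by (rule measurable_compose[OF meas]) measurable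
    fix F assume [measurable]: "F \<in> sets N"
    let ?E = "{\<xi>\<in>space M. g (T \<xi>, U \<xi>) \<in> B}"
    let ?\<phi> = "\<lambda>x. indicator F (fst x) * indicator B (g x) :: ennreal"
    have "(\<integral>\<^sup>+\<omega>. indicator F (T \<omega>) * indicator ?E \<omega> \<partial>M) = (\<integral>\<^sup>+\<omega>. ?\<phi> (T \<omega>, U \<omega>) \<partial>M)"
      by (auto intro!: nn_integral_cong split: split_indicator)
    also have "\<dots> = (\<integral>\<^sup>+\<omega>. \<integral>\<^sup>+u. ?\<phi> (T \<omega>, u) \<partial>K (T \<omega>) \<partial>M)"
      by (rule nn_integral_cond_distribution[OF U T K]) measurable
    also have "\<dots> = (\<integral>\<^sup>+\<omega>. indicator F (T \<omega>) * emeasure (distr (K (T \<omega>)) L (\<lambda>u. g (T \<omega>, u))) B \<partial>M)"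
    proof (rule nn_integral_cong)
      fix \<omega> assume "\<omega> \<in> space M"
      then have t: "T \<omega> \<in> space N"
        using measurable_space[OF T] by auto
      have [measurable]: "(\<lambda>u. g (T \<omega>, u)) \<in> K (T \<omega>) \<rightarrow>\<^sub>M L"
        using t by (simp add: measurable_cong_sets[OF subprob_measurableD(2)[OF KS t] refl])
      have "emeasure (distr (K (T \<omega>)) L (\<lambda>u. g (T \<omega>, u))) B = (\<integral>\<^sup>+u. indicator B (g (T \<omega>, u)) \<partial>K (T \<omega>))"
        by (simp add: nn_integral_distr flip: nn_integral_indicator)
      then show "(\<integral>\<^sup>+u. ?\<phi> (T \<omega>, u) \<partial>K (T \<omega>))
          = indicator F (T \<omega>) * emeasure (distr (K (T \<omega>)) L (\<lambda>u. g (T \<omega>, u))) B"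
        by (simp add: nn_integral_cmult)
    qed
    finally show "(\<integral>\<^sup>+\<omega>. indicator F (T \<omega>) * indicator ?E \<omega> \<partial>M)
        = (\<integral>\<^sup>+\<omega>. indicator F (T \<omega>) * emeasure (distr (K (T \<omega>)) L (\<lambda>u. g (T \<omega>, u))) B \<partial>M)" .
  qed measurable
qed

section \<open>Mixtures and uniqueness of conditional densities\<close>

text \<open>This is the tower property: condition on \<open>(Z, W)\<close> first, then average
  \<open>Z\<close> over its kernel given \<open>W\<close>. Tonelli, with \<nu> sigma-finite, moves
  the average inside the integral over \<open>B\<close>.\<close>

lemma cond_density_mixture:
  assumes \<nu>: "sigma_finite_measure \<nu>"
    and X[measurable]: "X \<in> M \<rightarrow>\<^sub>M \<nu>" and Z[measurable]: "Z \<in> M \<rightarrow>\<^sub>M MZ" and W[measurable]: "W \<in> M \<rightarrow>\<^sub>M MW"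
    and p: "cond_density M \<nu> X (MZ \<Otimes>\<^sub>M MW) (\<lambda>\<omega>. (Z \<omega>, W \<omega>)) p"
    and H: "cond_distribution M MZ Z MW W H"
  shows "cond_density M \<nu> X MW W (\<lambda>w a. \<integral>\<^sup>+z. p (z, w) a \<partial>H w)"
proof -
  interpret \<nu>: sigma_finite_measure \<nu> by fact
  have HP: "H \<in> MW \<rightarrow>\<^sub>M prob_algebra MZ"
    using H by (simp add: cond_distribution_def)
  then have HS[measurable]: "H \<in> MW \<rightarrow>\<^sub>M subprob_algebra MZ"
    by (rule measurable_prob_algebraD)
  have [measurable]: "(\<lambda>(v, x). p v x) \<in> borel_measurable ((MZ \<Otimes>\<^sub>M MW) \<Otimes>\<^sub>M \<nu>)"
    using p by (simp add: cond_density_def)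
  have mix: "(\<lambda>x. \<integral>\<^sup>+z. p (z, fst x) (snd x) \<partial>H (fst x)) \<in> borel_measurable (MW \<Otimes>\<^sub>M \<nu>)"
    by (rule nn_integral_measurable_subprob_algebra2[where N=MZ]) measurable
  have "AE \<omega> in M. prob_given M MW W {\<xi>\<in>space M. X \<xi> \<in> B} \<omega> = (\<integral>\<^sup>+a\<in>B. (\<integral>\<^sup>+z. p (z, W \<omega>) a \<partial>H (W \<omega>)) \<partial>\<nu>)"
    if [measurable]: "B \<in> sets \<nu>" for B
  proof (rule prob_given_eqI)
    note mix[measurable]
    show "(\<lambda>w. \<integral>\<^sup>+a\<in>B. (\<integral>\<^sup>+z. p (z, w) a \<partial>H w) \<partial>\<nu>) \<in> borel_measurable MW"
      using measurable_compose[OF _ mix, of "\<lambda>x. x"] by (intro \<nu>.borel_measurable_nn_integral) (simp add: split_beta')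
    fix G assume [measurable]: "G \<in> sets MW"
    let ?E = "{\<xi>\<in>space M. X \<xi> \<in> B}"
    let ?q = "\<lambda>v. \<integral>\<^sup>+a\<in>B. p v a \<partial>\<nu>"
    \<comment> \<open>A test function of \<open>W\<close> is in particular one of
      \<open>(Z, W)\<close>, so the finer conditioning may be used.\<close>
    have "(\<integral>\<^sup>+\<omega>. indicator G (W \<omega>) * indicator ?E \<omega> \<partial>M) = (\<integral>\<^sup>+\<omega>. indicator G (W \<omega>) * ?q (Z \<omega>, W \<omega>) \<partial>M)"
      using nn_integral_indicator_prob_given_eq[where V="\<lambda>\<omega>. (Z \<omega>, W \<omega>)" and MV="MZ \<Otimes>\<^sub>M MW"
          and h="\<lambda>v. indicator G (snd v)" and E="?E" and f="\<lambda>\<omega>. ?q (Z \<omega>, W \<omega>)"] p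
      by (simp add: cond_density_def)
    also have "\<dots> = (\<integral>\<^sup>+\<omega>. \<integral>\<^sup>+z. indicator G (W \<omega>) * ?q (z, W \<omega>) \<partial>H (W \<omega>) \<partial>M)"
      by (rule nn_integral_cond_distribution[OF Z W H, where f="\<lambda>x. indicator G (fst x) * ?q (snd x, fst x)", simplified])
        measurable
    also have "\<dots> = (\<integral>\<^sup>+\<omega>. indicator G (W \<omega>) * (\<integral>\<^sup>+a\<in>B. (\<integral>\<^sup>+z. p (z, W \<omega>) a \<partial>H (W \<omega>)) \<partial>\<nu>) \<partial>M)"
    proof (rule nn_integral_cong)
      fix \<omega> assume "\<omega> \<in> space M"
      then have w: "W \<omega> \<in> space MW"
        using measurable_space[OF W] by auto
      have setsH: "sets (H (W \<omega>)) = sets MZ"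
        by (rule subprob_measurableD(2)[OF HS w])
      interpret Hw: subprob_space "H (W \<omega>)"
        by (rule subprob_space_kernel[OF HS w])
      interpret P: pair_sigma_finite "H (W \<omega>)" \<nu> ..
      have pw[measurable]: "(\<lambda>x. p (fst x, W \<omega>) (snd x)) \<in> borel_measurable (H (W \<omega>) \<Otimes>\<^sub>M \<nu>)"
        unfolding measurable_cong_sets[OF sets_pair_measure_cong[OF setsH refl] refl] using w by measurable
      have pz: "(\<lambda>z. p (z, W \<omega>) a) \<in> borel_measurable (H (W \<omega>))" if "a \<in> space \<nu>" for a
        unfolding measurable_cong_sets[OF setsH refl] using w that by measurable
      have "(\<integral>\<^sup>+z. ?q (z, W \<omega>) \<partial>H (W \<omega>)) = (\<integral>\<^sup>+a. \<integral>\<^sup>+z. p (z, W \<omega>) a * indicator B a \<partial>H (W \<omega>) \<partial>\<nu>)"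
        by (rule P.Fubini'[symmetric]) (simp add: split_beta')
      also have "\<dots> = (\<integral>\<^sup>+a\<in>B. (\<integral>\<^sup>+z. p (z, W \<omega>) a \<partial>H (W \<omega>)) \<partial>\<nu>)"
        by (intro nn_integral_cong nn_integral_multc pz)
      finally show "(\<integral>\<^sup>+z. indicator G (W \<omega>) * ?q (z, W \<omega>) \<partial>H (W \<omega>))
          = indicator G (W \<omega>) * (\<integral>\<^sup>+a\<in>B. (\<integral>\<^sup>+z. p (z, W \<omega>) a \<partial>H (W \<omega>)) \<partial>\<nu>)"
        by (cases "W \<omega> \<in> G") simp_all
    qed
    finally show "(\<integral>\<^sup>+\<omega>. indicator G (W \<omega>) * indicator ?E \<omega> \<partial>M)
        = (\<integral>\<^sup>+\<omega>. indicator G (W \<omega>) * (\<integral>\<^sup>+a\<in>B. (\<integral>\<^sup>+z. p (z, W \<omega>) a \<partial>H (W \<omega>)) \<partial>\<nu>) \<partial>M)" .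
  qed measurable
  then show ?thesis
    using mix by (simp add: cond_density_def split_beta')
qed

text \<open>Relative to the product of the law of \<open>V\<close> with \<nu>, both functions are
  densities of the joint law of \<open>(V, X)\<close>. That law has finite mass, so they agree
  almost everywhere for the product.\<close>

lemma cond_density_unique:
  assumes \<nu>: "sigma_finite_measure \<nu>"
    and X[measurable]: "X \<in> M \<rightarrow>\<^sub>M \<nu>" and V[measurable]: "V \<in> M \<rightarrow>\<^sub>M MV"
    and g: "cond_density M \<nu> X MV V g" and g': "cond_density M \<nu> X MV V g'"
  shows "AE (v, a) in distr M MV V \<Otimes>\<^sub>M \<nu>. g v a = g' v a"
proof -
  interpret \<nu>: sigma_finite_measure \<nu> by fact
  let ?N = "distr M MV V \<Otimes>\<^sub>M \<nu>"
  \<comment> \<open>The right-hand side does not mention \<open>q\<close>, which is what forces two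
    conditional densities to define the same measure.\<close>
  have rect: "emeasure (density ?N (\<lambda>(v, a). q v a)) (G \<times> B)
      = (\<integral>\<^sup>+\<omega>. indicator G (V \<omega>) * indicator {\<xi>\<in>space M. X \<xi> \<in> B} \<omega> \<partial>M)"
    if q: "cond_density M \<nu> X MV V q" and [measurable]: "G \<in> sets MV" "B \<in> sets \<nu>" for q G B
  proof -
    have [measurable]: "(\<lambda>(v, a). q v a) \<in> borel_measurable (MV \<Otimes>\<^sub>M \<nu>)"
      using q by (simp add: cond_density_def)
    have [measurable]: "(\<lambda>a. q v a) \<in> borel_measurable \<nu>" if "v \<in> space MV" for v
      using that by measurable
    have "emeasure (density ?N (\<lambda>(v, a). q v a)) (G \<times> B)
        = (\<integral>\<^sup>+x. q (fst x) (snd x) * indicator (G \<times> B) x \<partial>?N)"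
      by (simp add: emeasure_density split_beta')
    also have "\<dots> = (\<integral>\<^sup>+v. \<integral>\<^sup>+a. q v a * indicator (G \<times> B) (v, a) \<partial>\<nu> \<partial>distr M MV V)"
      by (subst \<nu>.nn_integral_fst[symmetric]) simp_all
    also have "\<dots> = (\<integral>\<^sup>+v. indicator G v * (\<integral>\<^sup>+a\<in>B. q v a \<partial>\<nu>) \<partial>distr M MV V)"
    proof (rule nn_integral_cong)
      fix v
      show "(\<integral>\<^sup>+a. q v a * indicator (G \<times> B) (v, a) \<partial>\<nu>) = indicator G v * (\<integral>\<^sup>+a\<in>B. q v a \<partial>\<nu>)"
        by (cases "v \<in> G") (simp_all add: indicator_times)
    qed
    also have "\<dots> = (\<integral>\<^sup>+\<omega>. indicator G (V \<omega>) * (\<integral>\<^sup>+a\<in>B. q (V \<omega>) a \<partial>\<nu>) \<partial>M)"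
      by (subst nn_integral_distr) simp_all
    also have "\<dots> = (\<integral>\<^sup>+\<omega>. indicator G (V \<omega>) * indicator {\<xi>\<in>space M. X \<xi> \<in> B} \<omega> \<partial>M)"
      using q by (intro nn_integral_indicator_prob_given_eq[OF V, symmetric]) (simp_all add: cond_density_def)
    finally show ?thesis .
  qed
  have fin: "emeasure (density ?N (\<lambda>(v, a). g v a)) (space (MV \<Otimes>\<^sub>M \<nu>)) \<noteq> \<infinity>"
  proof -
    have "emeasure (density ?N (\<lambda>(v, a). g v a)) (space MV \<times> space \<nu>) \<le> (\<integral>\<^sup>+\<omega>. 1 \<partial>M)"
      unfolding rect[OF g sets.top sets.top] by (intro nn_integral_mono) (auto split: split_indicator)
    then show ?thesis
      by (auto simp: emeasure_space_1 top_unique space_pair_measure)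
  qed
  have [measurable]: "(\<lambda>(v, a). g v a) \<in> borel_measurable (MV \<Otimes>\<^sub>M \<nu>)" "(\<lambda>(v, a). g' v a) \<in> borel_measurable (MV \<Otimes>\<^sub>M \<nu>)"
    using g g' by (simp_all add: cond_density_def)
  have "density ?N (\<lambda>(v, a). g v a) = density ?N (\<lambda>(v, a). g' v a)"
    by (rule measure_eqI_rectangles[OF _ _ fin]) (simp_all add: rect[OF g] rect[OF g'])
  moreover have "(\<integral>\<^sup>+x. (case x of (v, a) \<Rightarrow> g v a) \<partial>?N) \<noteq> \<infinity>"
  proof -
    have "emeasure (density ?N (\<lambda>(v, a). g v a)) (space ?N) = (\<integral>\<^sup>+x. (case x of (v, a) \<Rightarrow> g v a) \<partial>?N)"
      using sets.top[of ?N] by (subst emeasure_density) (auto intro!: nn_integral_cong)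
    with fin show ?thesis by (simp add: space_pair_measure)
  qed
  ultimately have "AE x in ?N. (case x of (v, a) \<Rightarrow> g v a) = (case x of (v, a) \<Rightarrow> g' v a)"
    by (subst (asm) finite_density_unique) simp_all
  then show ?thesis
    by (simp add: split_beta')
qed

end

section \<open>The treatment density under the intervention\<close>

theorem theorem3:
  fixes M :: "'s measure"
    and MUW :: "'uw measure" and MUZ :: "'uz measure" and MUA :: "'ua measure" and MUY :: "'uy measure"
    and MW :: "'w measure" and MZ :: "'z measure" and \<nu> :: "'a measure" and MY :: "'y measure"
    and UW :: "'s \<Rightarrow> 'uw" and UZ :: "'s \<Rightarrow> 'uz" and UA :: "'s \<Rightarrow> 'ua" and UY :: "'s \<Rightarrow> 'uy"
    and fW :: "'uw \<Rightarrow> 'w" and fZ fZs :: "'w \<times> 'uz \<Rightarrow> 'z"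
    and fA :: "'z \<times> 'w \<times> 'ua \<Rightarrow> 'a" and fY :: "'a \<times> 'w \<times> 'uy \<Rightarrow> 'y"
    and W :: "'s \<Rightarrow> 'w" and Z Zs :: "'s \<Rightarrow> 'z" and A As :: "'s \<Rightarrow> 'a" and Y Ys :: "'s \<Rightarrow> 'y"
    and \<mu> :: "'w \<Rightarrow> 'z measure" and hs :: "'w \<Rightarrow> 'z \<Rightarrow> ennreal" and Hs :: "'w \<Rightarrow> 'z measure"
    and p :: "'z \<times> 'w \<Rightarrow> 'a \<Rightarrow> ennreal"
  assumes "prob_space M" and "sigma_finite_measure \<nu>"
    and "UW \<in> M \<rightarrow>\<^sub>M MUW" and "UZ \<in> M \<rightarrow>\<^sub>M MUZ" and "UA \<in> M \<rightarrow>\<^sub>M MUA" and "UY \<in> M \<rightarrow>\<^sub>M MUY"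
    and "fW \<in> MUW \<rightarrow>\<^sub>M MW"
    and "fZ \<in> MW \<Otimes>\<^sub>M MUZ \<rightarrow>\<^sub>M MZ" and "fZs \<in> MW \<Otimes>\<^sub>M MUZ \<rightarrow>\<^sub>M MZ"
    and "fA \<in> MZ \<Otimes>\<^sub>M MW \<Otimes>\<^sub>M MUA \<rightarrow>\<^sub>M \<nu>"
    and "fY \<in> \<nu> \<Otimes>\<^sub>M MW \<Otimes>\<^sub>M MUY \<rightarrow>\<^sub>M MY"
    \<comment> \<open>natural model\<close>
    and "\<And>\<omega>. \<omega> \<in> space M \<Longrightarrow> W \<omega> = fW (UW \<omega>)"
    and "\<And>\<omega>. \<omega> \<in> space M \<Longrightarrow> Z \<omega> = fZ (W \<omega>, UZ \<omega>)"
    and "\<And>\<omega>. \<omega> \<in> space M \<Longrightarrow> A \<omega> = fA (Z \<omega>, W \<omega>, UA \<omega>)"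
    and "\<And>\<omega>. \<omega> \<in> space M \<Longrightarrow> Y \<omega> = fY (A \<omega>, W \<omega>, UY \<omega>)"
    and "cond_indep M MZ Z (MUA \<Otimes>\<^sub>M MUY) (\<lambda>\<omega>. (UA \<omega>, UY \<omega>)) MW W"
    \<comment> \<open>intervened model\<close>
    and "\<And>\<omega>. \<omega> \<in> space M \<Longrightarrow> Zs \<omega> = fZs (W \<omega>, UZ \<omega>)"
    and "\<And>\<omega>. \<omega> \<in> space M \<Longrightarrow> As \<omega> = fA (Zs \<omega>, W \<omega>, UA \<omega>)"
    and "\<And>\<omega>. \<omega> \<in> space M \<Longrightarrow> Ys \<omega> = fY (As \<omega>, W \<omega>, UY \<omega>)"
    and "cond_indep M MZ Zs (MUA \<Otimes>\<^sub>M MUY) (\<lambda>\<omega>. (UA \<omega>, UY \<omega>)) MW W"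
    \<comment> \<open>the stochastic intervention\<close>
    and "\<And>w. w \<in> space MW \<Longrightarrow> sets (\<mu> w) = sets MZ"
    and "\<And>w. w \<in> space MW \<Longrightarrow> hs w \<in> borel_measurable MZ"
    and "\<And>w. w \<in> space MW \<Longrightarrow> Hs w = density (\<mu> w) (hs w)"
    and "cond_distribution M MZ Zs MW W Hs"
    \<comment> \<open>the conditional density of the natural treatment, determined on the range of the intervention\<close>
    and "cond_density M \<nu> A (MZ \<Otimes>\<^sub>M MW) (\<lambda>\<omega>. (Z \<omega>, W \<omega>)) p"
    and "absolutely_continuous
           (distr M (MZ \<Otimes>\<^sub>M MW) (\<lambda>\<omega>. (Z \<omega>, W \<omega>))) (distr M (MZ \<Otimes>\<^sub>M MW) (\<lambda>\<omega>. (Zs \<omega>, W \<omega>)))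
         \<or> structural_version M MUA UA MW W MZ fA \<nu> p"
  shows "cond_density M \<nu> As MW W (\<lambda>w a. \<integral>\<^sup>+z. p (z, w) a \<partial>Hs w) \<and>
    (\<forall>g. cond_density M \<nu> As MW W g \<longrightarrow>
      (AE (w, a) in distr M MW W \<Otimes>\<^sub>M \<nu>.
        g w a = (\<integral>\<^sup>+z. p (z, w) a * hs w z \<partial>\<mu> w) \<and>
        g w a = (\<integral>\<^sup>+z. p (z, w) a \<partial>Hs w)))"
proof -
  note [measurable] = assms(3-11)
  interpret prob_space M by fact
  interpret \<nu>: sigma_finite_measure \<nu> by fact
  have W[measurable]: "W \<in> M \<rightarrow>\<^sub>M MW"
    by (subst measurable_cong[OF assms(12)]) measurable
  have Z[measurable]: "Z \<in> M \<rightarrow>\<^sub>M MZ" and Zs[measurable]: "Zs \<in> M \<rightarrow>\<^sub>M MZ"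
    by (subst measurable_cong[OF assms(13)] measurable_cong[OF assms(17)], assumption, measurable)+
  have As[measurable]: "As \<in> M \<rightarrow>\<^sub>M \<nu>"
    by (subst measurable_cong[OF assms(18)]) measurable
  let ?N = "MZ \<Otimes>\<^sub>M MW" and ?T = "\<lambda>\<omega>. (Z \<omega>, W \<omega>)" and ?Ts = "\<lambda>\<omega>. (Zs \<omega>, W \<omega>)"
  \<comment> \<open>\<open>?g\<close> regroups the arguments of \<open>fA\<close> as a pair of the
    conditioning value \<open>(z, w)\<close> and the error \<open>u\<close>.\<close>
  let ?g = "\<lambda>x. fA (fst (fst x), snd (fst x), snd x)"
  have g[measurable]: "?g \<in> ?N \<Otimes>\<^sub>M MUA \<rightarrow>\<^sub>M \<nu>" by measurable
  have p[measurable]: "(\<lambda>(v, x). p v x) \<in> borel_measurable (?N \<Otimes>\<^sub>M \<nu>)"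
    using assms(25) by (simp add: cond_density_def)
  have UY: "UY \<omega> \<in> space MUY" if "\<omega> \<in> space M" for \<omega>
    using measurable_space[OF assms(6) that] .
  have ind: "cond_indep M MZ Z MUA UA MW W" and inds: "cond_indep M MZ Zs MUA UA MW W"
    using cond_indep_Pair_fst[OF UY assms(16)] cond_indep_Pair_fst[OF UY assms(20)] by auto
  have "cond_density M \<nu> As ?N ?Ts p"
    unfolding cond_density_def
  proof (intro conjI ballI p)
    fix B assume B[measurable]: "B \<in> sets \<nu>"
    from assms(26) show "AE \<omega> in M. prob_given M ?N ?Ts {\<xi>\<in>space M. As \<xi> \<in> B} \<omega> = (\<integral>\<^sup>+x\<in>B. p (?Ts \<omega>) x \<partial>\<nu>)"
    proof
      assume ac: "absolutely_continuous (distr M ?N ?T) (distr M ?N ?Ts)"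
      \<comment> \<open>\<open>?D\<close> turns both treatment events into the same event about the
        pair of conditioning variable and \<open>UA\<close>; only \<open>?T\<close> or
        \<open>?Ts\<close> differs.\<close>
      let ?D = "?g -` B \<inter> space (?N \<Otimes>\<^sub>M MUA)"
      have EA: "{\<xi>\<in>space M. A \<xi> \<in> B} = {\<xi>\<in>space M. (?T \<xi>, UA \<xi>) \<in> ?D}"
        and EAs: "{\<xi>\<in>space M. As \<xi> \<in> B} = {\<xi>\<in>space M. (?Ts \<xi>, UA \<xi>) \<in> ?D}"
        using assms(14,18) measurable_space[OF W] measurable_space[OF Z] measurable_space[OF Zs]
          measurable_space[OF assms(5)]
        by (auto simp: space_pair_measure)
      have "AE \<omega> in M. prob_given M ?N ?Ts {\<xi>\<in>space M. (?Ts \<xi>, UA \<xi>) \<in> ?D} \<omega> = (\<lambda>v. \<integral>\<^sup>+x\<in>B. p v x \<partial>\<nu>) (?Ts \<omega>)"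
      proof (rule prob_given_absolutely_continuous[where T="?T" and MU=MUA, OF _ _ _ ac])
        fix C assume [measurable]: "C \<in> sets MUA"
        \<comment> \<open>A single version given \<open>W\<close> is fixed here; the two conditional
          independences extend it to \<open>(Z, W)\<close> and to \<open>(Zs, W)\<close>.\<close>
        obtain k where [measurable]: "k \<in> borel_measurable MW"
          and k: "AE \<omega> in M. prob_given M MW W {\<xi>\<in>space M. UA \<xi> \<in> C} \<omega> = k (W \<omega>)"
          by (rule prob_given_factorization[OF W, of "{\<xi>\<in>space M. UA \<xi> \<in> C}"]) measurable
        show "\<exists>k\<in>borel_measurable ?N.
          (AE \<omega> in M. prob_given M ?N ?T {\<xi>\<in>space M. UA \<xi> \<in> C} \<omega> = k (?T \<omega>)) \<and>
          (AE \<omega> in M. prob_given M ?N ?Ts {\<xi>\<in>space M. UA \<xi> \<in> C} \<omega> = k (?Ts \<omega>))"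
        proof (intro bexI conjI)
          show "(\<lambda>v. k (snd v)) \<in> borel_measurable ?N" by measurable
          show "AE \<omega> in M. prob_given M ?N ?T {\<xi>\<in>space M. UA \<xi> \<in> C} \<omega> = k (snd (?T \<omega>))"
            using prob_given_cond_indep[OF Z assms(5) W ind _ _ k] by simp
          show "AE \<omega> in M. prob_given M ?N ?Ts {\<xi>\<in>space M. UA \<xi> \<in> C} \<omega> = k (snd (?Ts \<omega>))"
            using prob_given_cond_indep[OF Zs assms(5) W inds _ _ k] by simp
        qed
      next
        show "AE \<omega> in M. prob_given M ?N ?T {\<xi>\<in>space M. (?T \<xi>, UA \<xi>) \<in> ?D} \<omega> = (\<integral>\<^sup>+x\<in>B. p (?T \<omega>) x \<partial>\<nu>)"
          using assms(25) B unfolding cond_density_def EA[symmetric] by blast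
      qed measurable
      then show ?thesis
        unfolding EAs by simp
    next
      assume "structural_version M MUA UA MW W MZ fA \<nu> p"
      then obtain K where K: "cond_distribution M MUA UA MW W K"
        and Kp: "AE w in distr M MW W. \<forall>z\<in>space MZ. distr (K w) \<nu> (\<lambda>u. fA (z, w, u)) = density \<nu> (p (z, w))"
        unfolding structural_version_def by blast
      have EAs: "{\<xi>\<in>space M. As \<xi> \<in> B} = {\<xi>\<in>space M. ?g (?Ts \<xi>, UA \<xi>) \<in> B}"
        using assms(18) by auto
      have "AE \<omega> in M. prob_given M ?N ?Ts {\<xi>\<in>space M. ?g (?Ts \<xi>, UA \<xi>) \<in> B} \<omega>
          = emeasure (distr (case ?Ts \<omega> of (z, w) \<Rightarrow> K w) \<nu> (\<lambda>u. ?g (?Ts \<omega>, u))) B"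
        by (rule prob_given_image_cond_distribution[OF _ _ cond_distribution_cond_indep[OF Zs assms(5) W inds K] g B])
          measurable
      \<comment> \<open>The exceptional set concerns \<open>W\<close> only and the identity holds
        for all \<open>z\<close> at once, so \<open>z\<close> may be set to
        \<open>Zs \<omega>\<close> even where the law of \<open>(Z, W)\<close> puts no mass.\<close>
      moreover have "AE \<omega> in M. \<forall>z\<in>space MZ. distr (K (W \<omega>)) \<nu> (\<lambda>u. fA (z, W \<omega>, u)) = density \<nu> (p (z, W \<omega>))"
        by (rule AE_distrD[OF W Kp])
      ultimately show ?thesis
        using AE_space
      proof eventually_elim
        case (elim \<omega>)
        then have v: "Zs \<omega> \<in> space MZ" "W \<omega> \<in> space MW"
          using measurable_space[OF Zs] measurable_space[OF W] by auto
        then have "p (Zs \<omega>, W \<omega>) \<in> borel_measurable \<nu>"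
          using measurable_compose_Pair1[OF _ p, of "(Zs \<omega>, W \<omega>)"] by (simp add: space_pair_measure)
        then show ?case
          using elim v B by (simp add: EAs emeasure_density)
      qed
    qed
  qed
  then have dens: "cond_density M \<nu> As MW W (\<lambda>w a. \<integral>\<^sup>+z. p (z, w) a \<partial>Hs w)"
    by (rule cond_density_mixture[OF assms(2) As Zs W _ assms(24)])
  \<comment> \<open>This identifies the two integral forms pointwise on the spaces;
    \<open>AE_space\<close> later supplies the membership of \<open>w\<close> and
    \<open>a\<close>.\<close>
  have Hs: "(\<integral>\<^sup>+z. p (z, w) a \<partial>Hs w) = (\<integral>\<^sup>+z. p (z, w) a * hs w z \<partial>\<mu> w)"
    if wa: "w \<in> space MW" "a \<in> space \<nu>" for w a
  proof -
    have "(\<lambda>z. p (z, w) a) \<in> borel_measurable MZ"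
      using wa by measurable
    then show ?thesis
      unfolding assms(23)[OF wa(1)] using assms(22)[OF wa(1)] measurable_cong_sets[OF assms(21)[OF wa(1)] refl]
      by (subst nn_integral_density) (auto simp: mult.commute)
  qed
  show ?thesis
  proof (intro conjI allI impI dens)
    fix g assume "cond_density M \<nu> As MW W g"
    from cond_density_unique[OF assms(2) As W this dens] AE_space
    show "AE (w, a) in distr M MW W \<Otimes>\<^sub>M \<nu>.
        g w a = (\<integral>\<^sup>+z. p (z, w) a * hs w z \<partial>\<mu> w) \<and> g w a = (\<integral>\<^sup>+z. p (z, w) a \<partial>Hs w)"
      by eventually_elim (auto simp: space_pair_measure Hs)
  qed
qed

end
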